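(* Let $\{X(t),t\ge0\}$ be a stochastic process with stationary increments defined on a probability space $(\Omega,\mathcal F,P)$, and let $T>0$. Suppose that: (a) for every $\alpha<0$ there is $m_0\in\mathbb{N}$ such that $E\big[\max_{l=1,\dots,m_0}|X(l)-X(l-1)|\big]^{\alpha}<\infty$; (b) for every $c>0$ there is a random variable $M(c)$, independent of $\{X(t)\}$, such that $\{X(ct)\}$ and $\{M(c)X(t)\}$ have the same finite dimensional distributions; (c) the random factor $M$ satisfies moment scaling with scaling function $\tau$: there are functions $c(q)$, $\tau(q)$ such that $E|M(t)|^q=c(q)\,t^{\tau(q)}$ for all $t\in(0,T]$ and all $q$ for which $E|M(T)|^q<\infty$. If $E|M(T)|^q<\infty$ for some $q<0$, then for $P$-a.e. $\omega\in\Omega$ it holds that for each $$\gamma>\frac{\tau(q)}{q}-\frac1q$$ the path $t\mapsto X(t,\omega)$, $t\in[0,T]$, is nowhere Hölder continuous of order $\gamma$. In particular, for almost every sample path, $$H(t)\le H^+\qquad\text{for each } t\in[0,T],$$ where $H(t)$ is the pointwise Hölder exponent of the path at $t$ and $$H^+=\inf\left\{\frac{\tau(q)}{q}-\frac1q:\ q<0,\ E|M(T)|^q<\infty\right\}.$$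
   Context: All processes are real-valued, measurable, separable, not a.s. constant, and stochastically continuous at zero, i.e. $P(|X(h)|>\varepsilon)\to0$ as $h\to0$ for every $\varepsilon>0$. Stationary increments means that for every $s\ge0$ the processes $\{X(s+t)-X(s)\}_{t\ge0}$ and $\{X(t)-X(0)\}_{t\ge0}$ have the same finite dimensional distributions. A function $f:[0,T]\to\mathbb{R}$ is $C^{\gamma}(t_0)$ if there is $C>0$ such that $|f(t)-f(t_0)|\le C|t-t_0|^{\gamma}$ for all $t\in[0,T]$ in some neighbourhood of $t_0$; $f$ is nowhere Hölder continuous of order $\gamma$ if $f\notin C^{\gamma}(t_0)$ for every $t_0\in[0,T]$. The pointwise Hölder exponent is $H(t_0)=\sup\{\gamma\ge0:f\in C^{\gamma}(t_0)\}$ with $\sup\emptyset=0$. For $q<0$, $0^q=+\infty$. *)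

theory Defs
  imports "HOL-Probability.Probability"
begin

text \<open>Processes indexed by \<open>[0, \<infinity>)\<close> are functions \<open>real \<Rightarrow> 'a \<Rightarrow> real\<close>; only
  their values at times \<open>t \<ge> 0\<close> are ever used.\<close>

definition measurable_process :: "'a measure \<Rightarrow> (real \<Rightarrow> 'a \<Rightarrow> real) \<Rightarrow> bool" where
  "measurable_process P X \<longleftrightarrow>
     (\<lambda>(t, \<omega>). X t \<omega>) \<in> borel_measurable (restrict_space borel {0..} \<Otimes>\<^sub>M P)"

text \<open>Separability in the sense of Doob, with respect to the closed subsets of the line. The
  intervals that are open relative to \<open>[0, \<infinity>)\<close> are the sets \<open>{a<..<b} \<inter> {0..}\<close>.\<close>

definition separable_process :: "'a measure \<Rightarrow> (real \<Rightarrow> 'a \<Rightarrow> real) \<Rightarrow> bool" where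
  "separable_process P X \<longleftrightarrow>
     (\<exists>D N. countable D \<and> D \<subseteq> {0..} \<and> {0..} \<subseteq> closure D \<and> N \<in> null_sets P \<and>
        (\<forall>a b F. closed F \<longrightarrow>
           {\<omega> \<in> space P. \<forall>t \<in> {a<..<b} \<inter> D. X t \<omega> \<in> F}
             - {\<omega> \<in> space P. \<forall>t \<in> {a<..<b} \<inter> {0..}. X t \<omega> \<in> F} \<subseteq> N))"

definition as_constant :: "'a measure \<Rightarrow> (real \<Rightarrow> 'a \<Rightarrow> real) \<Rightarrow> bool" where
  "as_constant P X \<longleftrightarrow> (\<exists>a. AE \<omega> in P. \<forall>t\<ge>0. X t \<omega> = a)"

definition stoch_continuous_at_zero :: "'a measure \<Rightarrow> (real \<Rightarrow> 'a \<Rightarrow> real) \<Rightarrow> bool" where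
  "stoch_continuous_at_zero P X \<longleftrightarrow>
     (\<forall>\<epsilon>>0. ((\<lambda>h. measure P {\<omega> \<in> space P. \<bar>X h \<omega>\<bar> > \<epsilon>}) \<longlongrightarrow> 0) (at_right 0))"

definition same_fdd ::
  "'a measure \<Rightarrow> (real \<Rightarrow> 'a \<Rightarrow> real) \<Rightarrow> (real \<Rightarrow> 'a \<Rightarrow> real) \<Rightarrow> bool" where
  "same_fdd P Y Z \<longleftrightarrow>
     (\<forall>J. finite J \<and> J \<subseteq> {0..} \<longrightarrow>
        distr P (Pi\<^sub>M J (\<lambda>_. borel)) (\<lambda>\<omega>. \<lambda>t\<in>J. Y t \<omega>) =
        distr P (Pi\<^sub>M J (\<lambda>_. borel)) (\<lambda>\<omega>. \<lambda>t\<in>J. Z t \<omega>))"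

text \<open>Independence of the generated sigma-algebras: \<^const>\<open>prob_space.indep_var\<close> does not
  apply because it requires both random variables to take values in the same type.\<close>

definition indep_of_process ::
  "'a measure \<Rightarrow> ('a \<Rightarrow> real) \<Rightarrow> (real \<Rightarrow> 'a \<Rightarrow> real) \<Rightarrow> bool" where
  "indep_of_process P Y X \<longleftrightarrow>
     prob_space.indep_set P
       (sets (vimage_algebra (space P) Y borel))
       (sets (vimage_algebra (space P) (\<lambda>\<omega>. \<lambda>t\<in>{0..}. X t \<omega>) (Pi\<^sub>M {0..} (\<lambda>_. borel))))"

definition stationary_increments :: "'a measure \<Rightarrow> (real \<Rightarrow> 'a \<Rightarrow> real) \<Rightarrow> bool" where
  "stationary_increments P X \<longleftrightarrow>
     (\<forall>s\<ge>0. same_fdd P (\<lambda>t \<omega>. X (s + t) \<omega> - X s \<omega>) (\<lambda>t \<omega>. X t \<omega> - X 0 \<omega>))"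

text \<open>The power \<open>x\<^sup>q\<close> for \<open>x \<ge> 0\<close> with \<open>0\<^sup>q = \<infinity>\<close> for \<open>q < 0\<close> and \<open>0\<^sup>0 = 1\<close>;
  in contrast, \<open>0 powr q = 0\<close> for every \<open>q\<close>.\<close>

definition ext_powr :: "real \<Rightarrow> real \<Rightarrow> ennreal" where
  "ext_powr x q =
     (if q = 0 then 1 else if x = 0 \<and> q < 0 then \<infinity> else ennreal (x powr q))"

definition abs_moment :: "'a measure \<Rightarrow> ('a \<Rightarrow> real) \<Rightarrow> real \<Rightarrow> ennreal" where
  "abs_moment P Y q = (\<integral>\<^sup>+ \<omega>. ext_powr \<bar>Y \<omega>\<bar> q \<partial>P)"

text \<open>The equation is stated in \<^typ>\<open>ereal\<close> because \<^const>\<open>ennreal\<close> would truncate a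
  negative right-hand side to \<open>0\<close>.\<close>

definition moment_scaling ::
  "'a measure \<Rightarrow> (real \<Rightarrow> 'a \<Rightarrow> real) \<Rightarrow> real \<Rightarrow> (real \<Rightarrow> real) \<Rightarrow> (real \<Rightarrow> real) \<Rightarrow> bool" where
  "moment_scaling P M T c \<tau> \<longleftrightarrow>
     (\<forall>q. abs_moment P (M T) q < \<infinity> \<longrightarrow>
        (\<forall>t\<in>{0<..T}. enn2ereal (abs_moment P (M t) q) = ereal (c q * t powr \<tau> q)))"

text \<open>The value of \<open>0 powr \<gamma>\<close> is immaterial below, since the left-hand side vanishes at
  \<open>t = t\<^sub>0\<close>.\<close>

definition holder_at :: "real \<Rightarrow> (real \<Rightarrow> real) \<Rightarrow> real \<Rightarrow> real \<Rightarrow> bool" where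
  "holder_at T f \<gamma> t\<^sub>0 \<longleftrightarrow>
     (\<exists>C>0. \<forall>\<^sub>F t in nhds t\<^sub>0. t \<in> {0..T} \<longrightarrow> \<bar>f t - f t\<^sub>0\<bar> \<le> C * \<bar>t - t\<^sub>0\<bar> powr \<gamma>)"

definition nowhere_holder :: "real \<Rightarrow> (real \<Rightarrow> real) \<Rightarrow> real \<Rightarrow> bool" where
  "nowhere_holder T f \<gamma> \<longleftrightarrow> (\<forall>t\<^sub>0\<in>{0..T}. \<not> holder_at T f \<gamma> t\<^sub>0)"

text \<open>The case distinction implements \<open>sup \<emptyset> = 0\<close>; the exponent may be \<open>\<infinity>\<close>.\<close>

definition holder_exponent :: "real \<Rightarrow> (real \<Rightarrow> real) \<Rightarrow> real \<Rightarrow> ereal" where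
  "holder_exponent T f t\<^sub>0 =
     (if {\<gamma>. \<gamma> \<ge> 0 \<and> holder_at T f \<gamma> t\<^sub>0} = {} then 0
      else SUP \<gamma>\<in>{\<gamma>. \<gamma> \<ge> 0 \<and> holder_at T f \<gamma> t\<^sub>0}. ereal \<gamma>)"

definition H_plus ::
  "'a measure \<Rightarrow> (real \<Rightarrow> 'a \<Rightarrow> real) \<Rightarrow> real \<Rightarrow> (real \<Rightarrow> real) \<Rightarrow> ereal" where
  "H_plus P M T \<tau> =
     (INF q\<in>{q. q < 0 \<and> abs_moment P (M T) q < \<infinity>}. ereal (\<tau> q / q - 1 / q))"

end

theory Submission
  imports Defs "HOL-Real_Asymp.Real_Asymp"
begin

text \<open>By stationarity, scaling and independence, the maximum of \<open>m\<close> successive increments over steps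
  of length \<open>h\<close> has the \<open>q\<close>-th moment of \<open>\<bar>M h\<bar>\<close>, of order \<open>h powr \<tau> q\<close>, times that of the unit
  steps. By Markov's inequality it is at most \<open>N * h powr \<gamma>\<close> with probability of order
  \<open>h powr (\<tau> q - \<gamma> * q)\<close>. A path that is \<open>\<gamma>\<close>-Hoelder at some point has such a block of small
  increments on every fine grid of \<open>[0, T]\<close>, and since \<open>\<tau> q - \<gamma> * q > 1\<close> the union bound over the
  roughly \<open>1 / h\<close> blocks tends to \<open>0\<close>. The bound on the exponent also needs \<open>H_plus \<ge> 0\<close>, because
  of the convention \<open>sup \<emptyset> = 0\<close>; it follows from stochastic continuity at \<open>0\<close>.\<close>

subsection \<open>Extended powers\<close>

lemma ext_powr_measurable [measurable]: "(\<lambda>x. ext_powr x q) \<in> borel_measurable borel"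
  unfolding ext_powr_def by measurable

text \<open>For \<open>q < 0\<close> the extended power never takes the value \<open>0\<close>, so
  infinity times any other value stays infinite and the convention at \<open>0\<close> is compatible
  with products.\<close>

lemma ext_powr_mult:
  assumes "q < 0" "x \<ge> 0" "y \<ge> 0"
  shows "ext_powr (x * y) q = ext_powr x q * ext_powr y q"
  using assms
  by (auto simp: ext_powr_def powr_mult ennreal_mult ennreal_mult_top ennreal_top_mult)

text \<open>Negative powers are decreasing, so a finite negative moment controls how often
  \<open>Z\<close> is small. The convention at \<open>0\<close> makes the pointwise inequality hold
  also where \<open>Z\<close> vanishes.\<close>

lemma Markov_ext_powr:
  assumes [measurable]: "Z \<in> borel_measurable P"
    and Z: "\<And>\<omega>. Z \<omega> \<ge> 0" and "a > 0" "q < 0"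
  shows "emeasure P {\<omega> \<in> space P. Z \<omega> \<le> a}
           \<le> ennreal (a powr - q) * (\<integral>\<^sup>+ \<omega>. ext_powr (Z \<omega>) q \<partial>P)"
proof -
  have le: "1 \<le> ennreal (a powr - q) * ext_powr (Z \<omega>) q" if "Z \<omega> \<le> a" for \<omega>
  proof (cases "Z \<omega> = 0")
    case True
    then show ?thesis
      using assms by (simp add: ext_powr_def ennreal_mult_top)
  next
    case False
    with Z[of \<omega>] have pos: "Z \<omega> > 0" by simp
    have "a powr q \<le> Z \<omega> powr q"
      using powr_mono2'[of q "Z \<omega>" a] \<open>q < 0\<close> that pos by simp
    then have "1 \<le> a powr - q * Z \<omega> powr q"
      using \<open>a > 0\<close> by (simp add: powr_minus field_simps)
    then show ?thesis
      using pos \<open>q < 0\<close> by (simp add: ext_powr_def flip: ennreal_mult ennreal_1)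
  qed
  have "emeasure P {\<omega> \<in> space P. Z \<omega> \<le> a}
      = (\<integral>\<^sup>+ \<omega>. indicator {\<omega> \<in> space P. Z \<omega> \<le> a} \<omega> \<partial>P)"
    by simp
  also have "\<dots> \<le> (\<integral>\<^sup>+ \<omega>. ennreal (a powr - q) * ext_powr (Z \<omega>) q \<partial>P)"
    by (intro nn_integral_mono) (auto simp: indicator_def le)
  also have "\<dots> = ennreal (a powr - q) * (\<integral>\<^sup>+ \<omega>. ext_powr (Z \<omega>) q \<partial>P)"
    by (rule nn_integral_cmult) simp
  finally show ?thesis .
qed

subsection \<open>Maximal increments along a grid\<close>

text \<open>The path is an argument, so that translating, rescaling or restricting the process
  becomes an operation on \<open>f\<close>. \<open>Max\<close> is unspecified on the empty set,
  hence the assumption \<open>m \<ge> 1\<close> wherever the value matters.\<close>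

definition max_increment :: "nat \<Rightarrow> real \<Rightarrow> (real \<Rightarrow> real) \<Rightarrow> real" where
  "max_increment m h f =
     Max ((\<lambda>l. \<bar>f (real l * h) - f ((real l - 1) * h)\<bar>) ` {1..m})"

text \<open>Measurability is asked at the grid points only, so that coordinate projections of a
  product space over just these points are covered too.\<close>

lemma max_increment_measurable:
  assumes "\<And>l. l \<le> m \<Longrightarrow> (\<lambda>\<omega>. f \<omega> (real l * h)) \<in> borel_measurable N"
  shows "(\<lambda>\<omega>. max_increment m h (f \<omega>)) \<in> borel_measurable N"
proof -
  have "(\<lambda>\<omega>. \<bar>f \<omega> (real l * h) - f \<omega> ((real l - 1) * h)\<bar>) \<in> borel_measurable N"
    if "l \<in> {1..m}" for l
    using assms[of l] assms[of "l - 1"] that by (auto simp: of_nat_diff)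
  then show ?thesis
    unfolding max_increment_def by (intro borel_measurable_Max) auto
qed

lemma max_increment_nonneg: "m \<ge> 1 \<Longrightarrow> max_increment m h f \<ge> 0"
  unfolding max_increment_def
  by (rule order.trans[OF abs_ge_zero Max_ge[OF _ imageI[of 1]]]) auto

lemma max_increment_le_iff:
  "m \<ge> 1 \<Longrightarrow> max_increment m h f \<le> a \<longleftrightarrow>
     (\<forall>l\<in>{1..m}. \<bar>f (real l * h) - f ((real l - 1) * h)\<bar> \<le> a)"
  unfolding max_increment_def by (subst Max_le_iff) auto

text \<open>Two step sizes are allowed so that both a change of time scale and a restriction of the
  path to the grid are instances.\<close>

lemma max_increment_cong:
  assumes "\<And>l. l \<le> m \<Longrightarrow> f (real l * h) = g (real l * k)"
  shows "max_increment m h f = max_increment m k g"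
  unfolding max_increment_def
proof (intro arg_cong[of _ _ Max] image_cong refl)
  fix l assume "l \<in> {1..m}"
  then show "\<bar>f (real l * h) - f ((real l - 1) * h)\<bar> = \<bar>g (real l * k) - g ((real l - 1) * k)\<bar>"
    using assms[of l] assms[of "l - 1"] by (auto simp: of_nat_diff)
qed

lemma max_increment_diff: "max_increment m h (\<lambda>t. f t - b) = max_increment m h f"
  unfolding max_increment_def by simp

lemma max_increment_mult:
  assumes "m \<ge> 1"
  shows "max_increment m h (\<lambda>t. b * f t) = \<bar>b\<bar> * max_increment m h f"
proof -
  have "\<bar>b\<bar> * Max ((\<lambda>l. \<bar>f (real l * h) - f ((real l - 1) * h)\<bar>) ` {1..m})
      = Max ((*) \<bar>b\<bar> ` (\<lambda>l. \<bar>f (real l * h) - f ((real l - 1) * h)\<bar>) ` {1..m})"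
    using assms by (intro mono_Max_commute) (auto simp: mono_def mult_left_mono)
  then show ?thesis
    unfolding max_increment_def by (simp add: image_image abs_mult flip: right_diff_distrib)
qed

section \<open>Moments under equality in law and under independence\<close>

lemma same_fdd_nn_integral:
  assumes "same_fdd P Y Z" "finite J" "J \<subseteq> {0..}"
    and "\<And>t. t \<in> J \<Longrightarrow> Y t \<in> borel_measurable P" "\<And>t. t \<in> J \<Longrightarrow> Z t \<in> borel_measurable P"
    and "g \<in> borel_measurable (Pi\<^sub>M J (\<lambda>_. borel))"
  shows "(\<integral>\<^sup>+ \<omega>. g (\<lambda>t\<in>J. Y t \<omega>) \<partial>P) = (\<integral>\<^sup>+ \<omega>. g (\<lambda>t\<in>J. Z t \<omega>) \<partial>P)"
proof -
  have eq: "distr P (Pi\<^sub>M J (\<lambda>_. borel)) (\<lambda>\<omega>. \<lambda>t\<in>J. Y t \<omega>) =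
        distr P (Pi\<^sub>M J (\<lambda>_. borel)) (\<lambda>\<omega>. \<lambda>t\<in>J. Z t \<omega>)"
    using assms(1-3) unfolding same_fdd_def by blast
  have Y: "(\<lambda>\<omega>. \<lambda>t\<in>J. Y t \<omega>) \<in> measurable P (Pi\<^sub>M J (\<lambda>_. borel))"
    and Z: "(\<lambda>\<omega>. \<lambda>t\<in>J. Z t \<omega>) \<in> measurable P (Pi\<^sub>M J (\<lambda>_. borel))"
    using assms(4,5) by (auto intro!: measurable_restrict)
  show ?thesis
    using nn_integral_distr[OF Y, of g] nn_integral_distr[OF Z, of g] assms(6) eq by simp
qed

text \<open>The maximum sees the path at only \<open>m + 1\<close> times, so its moments are
  determined by the finite dimensional distributions.\<close>

lemma same_fdd_max_increment:
  assumes fdd: "same_fdd P Y Z" and "h \<ge> 0"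
    and "\<And>t. t \<ge> 0 \<Longrightarrow> Y t \<in> borel_measurable P" "\<And>t. t \<ge> 0 \<Longrightarrow> Z t \<in> borel_measurable P"
  shows "(\<integral>\<^sup>+ \<omega>. ext_powr (max_increment m h (\<lambda>t. Y t \<omega>)) q \<partial>P) =
         (\<integral>\<^sup>+ \<omega>. ext_powr (max_increment m h (\<lambda>t. Z t \<omega>)) q \<partial>P)"
proof -
  define J where "J = (\<lambda>l. real l * h) ` {..m}"
  have J: "finite J" "J \<subseteq> {0..}"
    using \<open>h \<ge> 0\<close> by (auto simp: J_def)
  have "(\<lambda>f. max_increment m h f) \<in> borel_measurable (Pi\<^sub>M J (\<lambda>_. borel))"
    by (intro max_increment_measurable measurable_component_singleton) (auto simp: J_def)
  then have meas: "(\<lambda>f. ext_powr (max_increment m h f) q) \<in> borel_measurable (Pi\<^sub>M J (\<lambda>_. borel))"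
    by measurable
  have restrict: "max_increment m h (\<lambda>t\<in>J. f t) = max_increment m h f" for f
    by (rule max_increment_cong) (auto simp: J_def)
  show ?thesis
    using same_fdd_nn_integral[OF fdd J assms(3,4) meas] J by (auto simp: restrict)
qed

text \<open>Composition with \<open>f\<close> and \<open>g\<close> turns a real variable and a whole
  path into two variables of type \<open>ennreal\<close>, for which \<open>indep_var\<close> makes
  sense and the integral of the product factorises.\<close>

lemma (in prob_space) nn_integral_mult_indep_of_process:
  assumes indep: "indep_of_process M Y X"
    and [measurable]: "Y \<in> borel_measurable M" and X: "\<And>t. t \<ge> 0 \<Longrightarrow> X t \<in> borel_measurable M"
    and [measurable]: "f \<in> borel_measurable borel" and g: "g \<in> borel_measurable (Pi\<^sub>M {0..} (\<lambda>_. borel))"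
  shows "(\<integral>\<^sup>+ \<omega>. f (Y \<omega>) * g (\<lambda>t\<in>{0..}. X t \<omega>) \<partial>M)
       = (\<integral>\<^sup>+ \<omega>. f (Y \<omega>) \<partial>M) * (\<integral>\<^sup>+ \<omega>. g (\<lambda>t\<in>{0..}. X t \<omega>) \<partial>M)"
proof -
  let ?X = "\<lambda>\<omega>. \<lambda>t\<in>{0..}. X t \<omega>"
  let ?A = "vimage_algebra (space M) Y borel"
  let ?B = "vimage_algebra (space M) ?X (Pi\<^sub>M {0..} (\<lambda>_. borel))"
  have X': "?X \<in> measurable M (Pi\<^sub>M {0..} (\<lambda>_. borel))"
    using X by (auto intro!: measurable_restrict)
  have fA: "(\<lambda>\<omega>. f (Y \<omega>)) \<in> borel_measurable ?A"
    by (rule measurable_compose[OF measurable_vimage_algebra1]) auto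
  have gB: "(\<lambda>\<omega>. g (?X \<omega>)) \<in> borel_measurable ?B"
    by (rule measurable_compose[OF measurable_vimage_algebra1 g])
       (use measurable_space[OF X'] in auto)
  \<comment> \<open>The events generated by a function measurable with respect to a
    \<open>vimage_algebra\<close> belong to that algebra, so independence passes to both
    compositions.\<close>
  have sub: "sigma_sets (space M) {u -` S \<inter> space M |S. S \<in> sets borel} \<subseteq> sets (vimage_algebra (space M) v N)"
    if "u \<in> borel_measurable (vimage_algebra (space M) v N)" for u :: "'a \<Rightarrow> ennreal" and v :: "'a \<Rightarrow> 'c" and N
  proof -
    have "{u -` S \<inter> space M |S. S \<in> sets borel} \<subseteq> sets (vimage_algebra (space M) v N)"
      using measurable_sets[OF that] by auto
    from sets.sigma_sets_subset[OF this] show ?thesis by simp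
  qed
  have "indep_var borel (\<lambda>\<omega>. f (Y \<omega>)) borel (\<lambda>\<omega>. g (?X \<omega>))"
    unfolding indep_var_eq
  proof (intro conjI)
    show "random_variable borel (\<lambda>\<omega>. g (?X \<omega>))"
      using measurable_compose[OF X' g] .
    show "indep_set (sigma_sets (space M) {(\<lambda>\<omega>. f (Y \<omega>)) -` S \<inter> space M |S. S \<in> sets borel})
        (sigma_sets (space M) {(\<lambda>\<omega>. g (?X \<omega>)) -` S \<inter> space M |S. S \<in> sets borel})"
      using indep sub[OF fA] sub[OF gB] unfolding indep_of_process_def indep_set_def
      by (elim indep_sets_mono_sets) (auto split: bool.split)
  qed simp
  \<comment> \<open>\<open>indep_var\<close> uses the family \<open>case_bool borel borel\<close>,
    which is identified here with the constant family.\<close>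
  then have *: "indep_vars (\<lambda>_. borel)
      (case_bool (\<lambda>\<omega>. f (Y \<omega>)) (\<lambda>\<omega>. g (?X \<omega>))) UNIV"
    unfolding indep_var_def by (rule back_subst[of "\<lambda>N. indep_vars N _ _"]) (auto split: bool.split)
  from indep_vars_nn_integral[OF _ *] show ?thesis
    by (simp add: UNIV_bool mult.commute)
qed

subsection \<open>Small increments have small probability\<close>

locale scaling_process = prob_space P for P :: "'a measure" +
  fixes X M :: "real \<Rightarrow> 'a \<Rightarrow> real"
  assumes X_measurable: "t \<ge> 0 \<Longrightarrow> X t \<in> borel_measurable P"
    and M_measurable: "r > 0 \<Longrightarrow> M r \<in> borel_measurable P"
    and stationary: "stationary_increments P X"
    and M_indep: "r > 0 \<Longrightarrow> indep_of_process P (M r) X"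
    and X_scaling: "r > 0 \<Longrightarrow> same_fdd P (\<lambda>t. X (r * t)) (\<lambda>t \<omega>. M r \<omega> * X t \<omega>)"
begin

lemma max_increment_X_measurable:
  assumes "h \<ge> 0" "s \<ge> 0"
  shows "(\<lambda>\<omega>. max_increment m h (\<lambda>t. X (s + t) \<omega>)) \<in> borel_measurable P"
  by (rule max_increment_measurable) (use assms in \<open>auto intro!: X_measurable\<close>)

lemma nn_integral_max_increment:
  assumes "m \<ge> 1" "q < 0" "h > 0" "s \<ge> 0"
  shows "(\<integral>\<^sup>+ \<omega>. ext_powr (max_increment m h (\<lambda>t. X (s + t) \<omega>)) q \<partial>P)
       = abs_moment P (M h) q * (\<integral>\<^sup>+ \<omega>. ext_powr (max_increment m 1 (\<lambda>t. X t \<omega>)) q \<partial>P)"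
proof -
  note [measurable] = X_measurable M_measurable
  \<comment> \<open>Subtracting \<open>X s \<omega>\<close> changes no increment and produces the
    process to which stationarity applies.\<close>
  have "(\<integral>\<^sup>+ \<omega>. ext_powr (max_increment m h (\<lambda>t. X (s + t) \<omega>)) q \<partial>P)
      = (\<integral>\<^sup>+ \<omega>. ext_powr (max_increment m h (\<lambda>t. X (s + t) \<omega> - X s \<omega>)) q \<partial>P)"
    by (simp add: max_increment_diff)
  also have "\<dots> = (\<integral>\<^sup>+ \<omega>. ext_powr (max_increment m h (\<lambda>t. X t \<omega> - X 0 \<omega>)) q \<partial>P)"
    by (rule same_fdd_max_increment)
       (use stationary assms in \<open>auto simp: stationary_increments_def\<close>)
  also have "\<dots> = (\<integral>\<^sup>+ \<omega>. ext_powr (max_increment m 1 (\<lambda>t. X (h * t) \<omega>)) q \<partial>P)"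
    by (auto simp: max_increment_diff mult.commute
        intro!: nn_integral_cong arg_cong[of _ _ "\<lambda>x. ext_powr x q"] max_increment_cong)
  also have "\<dots> = (\<integral>\<^sup>+ \<omega>. ext_powr (max_increment m 1 (\<lambda>t. M h \<omega> * X t \<omega>)) q \<partial>P)"
    by (rule same_fdd_max_increment) (use X_scaling assms in auto)
  \<comment> \<open>Independence concerns the path as a point of the product space over
    \<open>{0..}\<close>, so the path is restricted to that set, which contains the whole
    grid.\<close>
  also have "\<dots> = (\<integral>\<^sup>+ \<omega>. ext_powr \<bar>M h \<omega>\<bar> q * ext_powr (max_increment m 1 (\<lambda>t\<in>{0..}. X t \<omega>)) q \<partial>P)"
    using assms
    by (auto simp: max_increment_mult ext_powr_mult max_increment_nonneg
        intro!: nn_integral_cong arg_cong[of _ _ "\<lambda>x. _ * ext_powr x q"] max_increment_cong)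
  also have "\<dots> = (\<integral>\<^sup>+ \<omega>. ext_powr \<bar>M h \<omega>\<bar> q \<partial>P)
      * (\<integral>\<^sup>+ \<omega>. ext_powr (max_increment m 1 (\<lambda>t\<in>{0..}. X t \<omega>)) q \<partial>P)"
  proof (rule nn_integral_mult_indep_of_process[where f = "\<lambda>x. ext_powr \<bar>x\<bar> q"])
    show "(\<lambda>f. ext_powr (max_increment m 1 f) q) \<in> borel_measurable (Pi\<^sub>M {0..} (\<lambda>_. borel))"
      by (intro measurable_compose[OF _ ext_powr_measurable] max_increment_measurable
          measurable_component_singleton) auto
  qed (use M_indep assms in auto)
  also have "(\<integral>\<^sup>+ \<omega>. ext_powr (max_increment m 1 (\<lambda>t\<in>{0..}. X t \<omega>)) q \<partial>P)
      = (\<integral>\<^sup>+ \<omega>. ext_powr (max_increment m 1 (\<lambda>t. X t \<omega>)) q \<partial>P)"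
    by (auto intro!: nn_integral_cong arg_cong[of _ _ "\<lambda>x. ext_powr x q"] max_increment_cong)
  finally show ?thesis
    unfolding abs_moment_def .
qed

text \<open>The constant is \<open>c q\<close> times the moment of the unit block. It does not
  depend on \<open>s\<close>, \<open>h\<close> or \<open>a\<close>, which allows summing over the
  blocks of a grid and letting \<open>h\<close> tend to 0.\<close>

lemma prob_max_increment_le:
  assumes q: "q < 0" and m: "m \<ge> 1"
    and moment: "(\<integral>\<^sup>+ \<omega>. ext_powr (max_increment m 1 (\<lambda>t. X t \<omega>)) q \<partial>P) < \<infinity>"
    and c: "moment_scaling P M T c \<tau>" and M: "abs_moment P (M T) q < \<infinity>"
  obtains K where "\<And>s h a. s \<ge> 0 \<Longrightarrow> 0 < h \<Longrightarrow> h \<le> T \<Longrightarrow> a > 0 \<Longrightarrow>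
    prob {\<omega> \<in> space P. max_increment m h (\<lambda>t. X (s + t) \<omega>) \<le> a} \<le> K * (a powr - q * h powr \<tau> q)"
proof -
  obtain Y where Y: "Y \<ge> 0" "(\<integral>\<^sup>+ \<omega>. ext_powr (max_increment m 1 (\<lambda>t. X t \<omega>)) q \<partial>P) = ennreal Y"
    using moment by (auto simp: less_top elim!: ennreal_cases)
  show thesis
  proof (rule that[of "c q * Y"])
    fix s h a :: real
    assume *: "s \<ge> 0" "0 < h" "h \<le> T" "a > 0"
    have eq: "enn2ereal (abs_moment P (M h) q) = ereal (c q * h powr \<tau> q)"
      using c M * unfolding moment_scaling_def by auto
    \<comment> \<open>No sign is assumed for \<open>c q\<close>; equality with a moment forces this
      product to be nonnegative, so products in \<open>ennreal\<close> become real products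
      below.\<close>
    then have nonneg: "0 \<le> c q * h powr \<tau> q"
      by (metis enn2ereal_nonneg ereal_less_eq(5))
    have Mh: "abs_moment P (M h) q = ennreal (c q * h powr \<tau> q)"
      using eq by (metis e2ennreal_enn2ereal e2ennreal_ereal)
    have "emeasure P {\<omega> \<in> space P. max_increment m h (\<lambda>t. X (s + t) \<omega>) \<le> a}
        \<le> ennreal (a powr - q) * (\<integral>\<^sup>+ \<omega>. ext_powr (max_increment m h (\<lambda>t. X (s + t) \<omega>)) q \<partial>P)"
      using * q m by (intro Markov_ext_powr max_increment_X_measurable max_increment_nonneg) auto
    also have "\<dots> = ennreal (a powr - q * (c q * h powr \<tau> q * Y))"
      using * q m Y nonneg by (simp add: nn_integral_max_increment Mh ennreal_mult)
    finally have "prob {\<omega> \<in> space P. max_increment m h (\<lambda>t. X (s + t) \<omega>) \<le> a}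
        \<le> a powr - q * (c q * h powr \<tau> q * Y)"
      using nonneg Y by (simp add: emeasure_eq_measure)
    then show "prob {\<omega> \<in> space P. max_increment m h (\<lambda>t. X (s + t) \<omega>) \<le> a}
        \<le> c q * Y * (a powr - q * h powr \<tau> q)"
      by (simp add: mult_ac)
  qed
qed

end

subsection \<open>Hoelder continuity at a point\<close>

lemma holder_at_mono:
  assumes "holder_at T f \<gamma> t\<^sub>0" "\<gamma>' \<le> \<gamma>"
  shows "holder_at T f \<gamma>' t\<^sub>0"
proof -
  obtain C where C: "C > 0"
    "\<forall>\<^sub>F t in nhds t\<^sub>0. t \<in> {0..T} \<longrightarrow> \<bar>f t - f t\<^sub>0\<bar> \<le> C * \<bar>t - t\<^sub>0\<bar> powr \<gamma>"
    using assms(1) unfolding holder_at_def by blast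
  have "\<forall>\<^sub>F t in nhds t\<^sub>0. \<bar>t - t\<^sub>0\<bar> < 1"
    unfolding eventually_nhds_metric by (intro exI[of _ 1]) (auto simp: dist_real_def)
  with C(2) have "\<forall>\<^sub>F t in nhds t\<^sub>0. t \<in> {0..T} \<longrightarrow> \<bar>f t - f t\<^sub>0\<bar> \<le> C * \<bar>t - t\<^sub>0\<bar> powr \<gamma>'"
  proof eventually_elim
    case (elim t)
    have "\<bar>t - t\<^sub>0\<bar> powr \<gamma> \<le> \<bar>t - t\<^sub>0\<bar> powr \<gamma>'"
      \<comment> \<open>At \<open>t = t\<^sub>0\<close> both powers are \<open>0\<close>; elsewhere
        the base is below 1 and its powers decrease in the exponent.\<close>
      using elim(2) assms(2) by (cases "t = t\<^sub>0") (auto intro!: powr_mono')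
    then have "C * \<bar>t - t\<^sub>0\<bar> powr \<gamma> \<le> C * \<bar>t - t\<^sub>0\<bar> powr \<gamma>'"
      using C(1) by simp
    with elim(1) show ?case by linarith
  qed
  with C(1) show ?thesis
    unfolding holder_at_def by blast
qed

text \<open>The block keeps a distance of at least one step from \<open>t\<^sub>0\<close>, so that bounds by
  \<open>\<bar>t - t\<^sub>0\<bar> powr \<gamma>\<close> are uniform on the block also for negative \<open>\<gamma>\<close>.\<close>

lemma ex_grid_block:
  fixes T t\<^sub>0 :: real and m n :: nat
  assumes "T > 0" "t\<^sub>0 \<in> {0..T}" "n \<ge> 2 * m + 3"
  obtains j :: nat where "j + m \<le> n"
    "\<And>i::nat. j \<le> i \<Longrightarrow> i \<le> j + m \<Longrightarrow> T / n \<le> \<bar>i * (T / n) - t\<^sub>0\<bar> \<and> \<bar>i * (T / n) - t\<^sub>0\<bar> \<le> (m + 2) * (T / n)"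
proof -
  define h where "h = T / n"
  have h: "h > 0" and nh: "n * h = T"
    using assms by (simp_all add: h_def)
  define k where "k = nat \<lfloor>t\<^sub>0 / h\<rfloor>"
  have "real k \<le> t\<^sub>0 / h" "t\<^sub>0 / h < real k + 1"
    using assms h unfolding k_def by (auto simp: of_nat_nat)
  then have k: "k * h \<le> t\<^sub>0" "t\<^sub>0 < (k + 1) * h"
    using h by (auto simp: field_simps)
  show thesis
  \<comment> \<open>The block starts two steps after \<open>k\<close> if there is room, and
    otherwise ends one step before \<open>k\<close>. As \<open>t\<^sub>0\<close> lies between
    \<open>k * h\<close> and \<open>(k + 1) * h\<close>, either choice leaves a gap of at least one
    step.\<close>
  proof (cases "k + 2 + m \<le> n")
    case True
    show thesis
    proof (rule that[of "k + 2"], goal_cases)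
      case (2 i)
      then have "(k + 2) * h \<le> i * h" "i * h \<le> (k + 2 + m) * h"
        using h by (auto intro!: mult_right_mono)
      with k show ?case
        unfolding h_def[symmetric] by (auto simp: algebra_simps)
    qed (use True in auto)
  next
    case False
    then have ge: "k \<ge> m + 1" using assms by linarith
    have "k * h \<le> n * h" using k nh assms by auto
    then have "k \<le> n" using h by auto
    show thesis
    proof (rule that[of "k - 1 - m"], goal_cases)
      case (2 i)
      then have "real k \<le> real i + 1 + m" "real i + 1 \<le> real k"
        using ge by linarith+
      then have "real k * h \<le> (real i + 1 + m) * h" "(real i + 1) * h \<le> real k * h"
        using h by (auto intro!: mult_right_mono)
      with k show ?case
        unfolding h_def[symmetric] by (auto simp: algebra_simps abs_if)
    qed (use ge \<open>k \<le> n\<close> in auto)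
  qed
qed

text \<open>Neighbouring grid values are compared through \<open>f t\<^sub>0\<close>, which doubles
  the constant. It is rounded up to a natural number so that the exceptional events later form a
  countable family.\<close>

lemma holder_at_imp_small_increments:
  assumes "holder_at T f \<gamma> t\<^sub>0" "T > 0" "t\<^sub>0 \<in> {0..T}" "m \<ge> 1"
  obtains N :: nat where "N \<ge> 1"
    "\<forall>\<^sub>F n in sequentially. \<exists>j\<le>n.
       max_increment m (T / n) (\<lambda>t. f (j * (T / n) + t)) \<le> N * (T / n) powr \<gamma>"
proof -
  obtain C d where C: "C > 0" and d: "d > 0"
    "\<And>t. dist t t\<^sub>0 < d \<Longrightarrow> t \<in> {0..T} \<Longrightarrow> \<bar>f t - f t\<^sub>0\<bar> \<le> C * \<bar>t - t\<^sub>0\<bar> powr \<gamma>"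
    using assms(1) unfolding holder_at_def eventually_nhds_metric by blast
  \<comment> \<open>Distances to \<open>t\<^sub>0\<close> range from \<open>h\<close> to
    \<open>(m + 2) * h\<close>. The far end gives the factor for \<open>\<gamma> \<ge> 0\<close>,
    the near end gives the factor 1 for negative \<open>\<gamma>\<close>.\<close>
  define K where "K = max 1 ((m + 2) powr \<gamma>)"
  obtain N :: nat where N: "N \<ge> 1" "2 * C * K \<le> N"
    using real_arch_simple[of "max 1 (2 * C * K)"] by auto
  have "(\<lambda>n. (m + 2) * (T / real n)) \<longlonglongrightarrow> real (m + 2) * 0"
    by (intro tendsto_mult tendsto_const lim_const_over_n)
  then have "\<forall>\<^sub>F n in sequentially. (m + 2) * (T / real n) < d"
    using d(1) by (intro order_tendstoD) auto
  then have "\<forall>\<^sub>F n in sequentially. \<exists>j\<le>n.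
       max_increment m (T / n) (\<lambda>t. f (j * (T / n) + t)) \<le> N * (T / n) powr \<gamma>"
    using eventually_ge_at_top[of "2 * m + 3"]
  proof eventually_elim
    case (elim n)
    define h where "h = T / n"
    have h: "h > 0" and nh: "n * h = T"
      using assms elim by (auto simp: h_def)
    obtain j :: nat where j: "j + m \<le> n"
      "\<And>i::nat. j \<le> i \<Longrightarrow> i \<le> j + m \<Longrightarrow> h \<le> \<bar>i * h - t\<^sub>0\<bar> \<and> \<bar>i * h - t\<^sub>0\<bar> \<le> (m + 2) * h"
      using ex_grid_block[OF assms(2,3) elim(2)] unfolding h_def by blast
    have bound: "\<bar>f (i * h) - f t\<^sub>0\<bar> \<le> C * K * h powr \<gamma>" if i: "j \<le> i" "i \<le> j + m" for i :: nat
    proof -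
      have "i * h \<le> n * h"
        using i j(1) h by (intro mult_right_mono) auto
      then have "\<bar>f (i * h) - f t\<^sub>0\<bar> \<le> C * \<bar>i * h - t\<^sub>0\<bar> powr \<gamma>"
        using j(2)[OF i] elim(1) nh h assms(2)
        by (intro d(2)) (auto simp: dist_real_def h_def intro: order.strict_trans1)
      also have "\<bar>i * h - t\<^sub>0\<bar> powr \<gamma> \<le> K * h powr \<gamma>"
      proof (cases "\<gamma> \<ge> 0")
        case True
        have "\<bar>i * h - t\<^sub>0\<bar> powr \<gamma> \<le> ((m + 2) * h) powr \<gamma>"
          using j(2)[OF i] True by (intro powr_mono2) auto
        also have "\<dots> = (m + 2) powr \<gamma> * h powr \<gamma>"
          using h by (simp add: powr_mult)
        also have "\<dots> \<le> K * h powr \<gamma>"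
          by (intro mult_right_mono) (auto simp: K_def)
        finally show ?thesis .
      next
        case False
        have "\<bar>i * h - t\<^sub>0\<bar> powr \<gamma> \<le> 1 * h powr \<gamma>"
          using j(2)[OF i] False h powr_mono2'[of \<gamma> h] by auto
        also have "\<dots> \<le> K * h powr \<gamma>"
          by (intro mult_right_mono) (auto simp: K_def)
        finally show ?thesis .
      qed
      finally show ?thesis
        using C by (simp add: mult.assoc)
    qed
    have "max_increment m h (\<lambda>t. f (j * h + t)) \<le> N * h powr \<gamma>"
      unfolding max_increment_le_iff[OF assms(4)]
    proof
      fix l assume l: "l \<in> {1..m}"
      then have "j \<le> j + l - 1" "j + l - 1 \<le> j + m" by auto
      then have "\<bar>f ((j + l) * h) - f ((j + l - 1) * h)\<bar> \<le> 2 * C * K * h powr \<gamma>"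
        using bound[of "j + l"] bound[of "j + l - 1"] l by (simp add: of_nat_diff)
      also have "\<dots> \<le> N * h powr \<gamma>"
        using N by (intro mult_right_mono) auto
      finally show "\<bar>f (j * h + l * h) - f (j * h + (real l - 1) * h)\<bar> \<le> N * h powr \<gamma>"
        using l by (simp add: of_nat_diff algebra_simps)
    qed
    then show ?case
      using j(1) unfolding h_def by (intro exI[of _ j]) auto
  qed
  with N(1) show thesis by (rule that)
qed

section \<open>From a single exponent to all exponents and to the pointwise Hoelder exponent\<close>

lemma nowhere_holder_mono: "nowhere_holder T f \<gamma> \<Longrightarrow> \<gamma> \<le> \<gamma>' \<Longrightarrow> nowhere_holder T f \<gamma>'"
  unfolding nowhere_holder_def using holder_at_mono by blast

text \<open>A rational exponent fits strictly between \<open>B\<close> and \<open>\<gamma>\<close>,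
  so by monotonicity one null set, a countable union, serves all \<open>\<gamma>\<close>.\<close>

lemma AE_all_nowhere_holder:
  fixes B :: ereal
  assumes "\<And>\<gamma>. B < ereal \<gamma> \<Longrightarrow> AE \<omega> in P. nowhere_holder T (\<lambda>t. X t \<omega>) \<gamma>"
  shows "AE \<omega> in P. \<forall>\<gamma>. B < ereal \<gamma> \<longrightarrow> nowhere_holder T (\<lambda>t. X t \<omega>) \<gamma>"
proof -
  have "AE \<omega> in P. \<forall>r::rat. B < ereal (of_rat r) \<longrightarrow> nowhere_holder T (\<lambda>t. X t \<omega>) (of_rat r)"
    unfolding AE_all_countable using assms by auto
  then show ?thesis
  proof eventually_elim
    case (elim \<omega>)
    show ?case
    proof (intro allI impI)
      fix \<gamma> assume "B < ereal \<gamma>"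
      then obtain r :: rat where "B < ereal (of_rat r)" "ereal (of_rat r) < ereal \<gamma>"
        using ereal_dense3 by blast
      then show "nowhere_holder T (\<lambda>t. X t \<omega>) \<gamma>"
        using elim nowhere_holder_mono[of T _ "of_rat r" \<gamma>] by auto
    qed
  qed
qed

lemma holder_exponent_le:
  assumes "\<And>\<gamma>. B < ereal \<gamma> \<Longrightarrow> nowhere_holder T f \<gamma>" "B \<ge> 0" "t \<in> {0..T}"
  shows "holder_exponent T f t \<le> B"
proof -
  have "ereal \<gamma> \<le> B" if "holder_at T f \<gamma> t" for \<gamma>
    using that assms(1)[of \<gamma>] assms(3) unfolding nowhere_holder_def by (metis not_le)
  then show ?thesis
    using assms(2) unfolding holder_exponent_def by (auto intro: SUP_least)
qed

section \<open>Almost sure roughness and the sign of the scaling exponent\<close>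

context scaling_process
begin

lemma AE_nowhere_holder:
  assumes q: "q < 0" and m: "m \<ge> 1" and T: "T > 0"
    and moment: "(\<integral>\<^sup>+ \<omega>. ext_powr (max_increment m 1 (\<lambda>t. X t \<omega>)) q \<partial>P) < \<infinity>"
    and c: "moment_scaling P M T c \<tau>" and M: "abs_moment P (M T) q < \<infinity>"
    and \<gamma>: "\<gamma> > \<tau> q / q - 1 / q"
  shows "AE \<omega> in P. nowhere_holder T (\<lambda>t. X t \<omega>) \<gamma>"
proof -
  obtain K where K: "\<And>s h a. s \<ge> 0 \<Longrightarrow> 0 < h \<Longrightarrow> h \<le> T \<Longrightarrow> a > 0 \<Longrightarrow>
    prob {\<omega> \<in> space P. max_increment m h (\<lambda>t. X (s + t) \<omega>) \<le> a} \<le> K * (a powr - q * h powr \<tau> q)"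
    using prob_max_increment_le[OF q m moment c M] by blast
  \<comment> \<open>With \<open>a = N * h powr \<gamma>\<close> the probability bound is of order
    \<open>h powr \<beta>\<close>; multiplying the assumption on \<open>\<gamma>\<close> by the
    negative \<open>q\<close> gives \<open>\<beta> > 1\<close>.\<close>
  define \<beta> where "\<beta> = \<tau> q - \<gamma> * q"
  have "\<beta> > 1"
    using \<gamma> q by (simp add: \<beta>_def field_simps)
  \<comment> \<open>Blocks with \<open>j\<close> close to \<open>n\<close> extend beyond
    \<open>T\<close>, which is harmless because the process lives on the half-line and the bound is
    uniform in the starting point.\<close>
  define A where "A N n = (\<Union>j\<le>n. {\<omega> \<in> space P.
      max_increment m (T / n) (\<lambda>t. X (j * (T / n) + t) \<omega>) \<le> N * (T / n) powr \<gamma>})" for N n :: nat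
  have A_event: "{\<omega> \<in> space P. max_increment m (T / n) (\<lambda>t. X (j * (T / n) + t) \<omega>)
      \<le> N * (T / n) powr \<gamma>} \<in> events" for j n N :: nat
    using max_increment_X_measurable[of "T / n" "j * (T / n)" m] T
    by (intro borel_measurable_le borel_measurable_const) auto
  have [measurable]: "A N n \<in> events" for N n
    unfolding A_def by (intro sets.finite_UN finite_atMost A_event)
  have prob_A: "prob (A N n) \<le> K * N powr - q * ((real n + 1) * (T / n) powr \<beta>)"
    if "N \<ge> 1" "n \<ge> 1" for N n
  proof -
    have h: "0 < T / n" "T / n \<le> T"
      using T that by (auto simp: field_simps)
    have eq: "(N * (T / n) powr \<gamma>) powr - q * (T / n) powr \<tau> q = N powr - q * (T / n) powr \<beta>"
      using T by (simp add: powr_mult powr_powr \<beta>_def mult.assoc flip: powr_add)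
    have "prob (A N n) \<le> (\<Sum>j\<le>n. prob {\<omega> \<in> space P.
        max_increment m (T / n) (\<lambda>t. X (j * (T / n) + t) \<omega>) \<le> N * (T / n) powr \<gamma>})"
      unfolding A_def by (rule finite_measure_subadditive_finite) (use A_event in blast)+
    also have "\<dots> \<le> (\<Sum>j\<le>n. K * ((real N * (T / n) powr \<gamma>) powr - q * (T / n) powr \<tau> q))"
      by (rule sum_mono, rule K) (use h that in auto)
    also have "\<dots> = (real n + 1) * (K * ((N * (T / n) powr \<gamma>) powr - q * (T / n) powr \<tau> q))"
      by simp
    finally show ?thesis
      unfolding eq by (simp only: mult_ac)
  qed
  have lim: "(\<lambda>n. K * N powr - q * ((real n + 1) * (T / n) powr \<beta>)) \<longlonglongrightarrow> 0" for N :: nat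
  proof -
    have "(\<lambda>n. (real n + 1) * (T / n) powr \<beta>) \<longlonglongrightarrow> 0"
      using T \<open>\<beta> > 1\<close> by real_asymp
    from tendsto_mult_left[OF this] show ?thesis by simp
  qed
  have "AE \<omega> in P. \<not> (\<forall>n\<ge>n\<^sub>0. \<omega> \<in> A N n)" if N: "N \<ge> 1" for N n\<^sub>0
  proof -
    \<comment> \<open>\<open>S\<close> lies in every \<open>A N n\<close> with
      \<open>n \<ge> n\<^sub>0\<close>, so it suffices that these probabilities tend to 0; they need
      not be summable.\<close>
    define S where "S = {\<omega> \<in> space P. \<forall>n\<ge>n\<^sub>0. \<omega> \<in> A N n}"
    have [measurable]: "S \<in> events"
      unfolding S_def by (intro sets.sets_Collect_countable_All sets.sets_Collect_imp) auto
    have "prob S \<le> K * N powr - q * ((real n + 1) * (T / n) powr \<beta>)" if n: "n \<ge> max 1 n\<^sub>0" for n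
    proof -
      have "prob S \<le> prob (A N n)"
        using n by (intro finite_measure_mono) (auto simp: S_def)
      also have "\<dots> \<le> K * N powr - q * ((real n + 1) * (T / n) powr \<beta>)"
        using n N by (intro prob_A) auto
      finally show ?thesis .
    qed
    then have "prob S \<le> 0"
      by (intro LIMSEQ_le_const[OF lim[of N]]) blast
    then have "prob S = 0"
      by (simp add: measure_le_0_iff)
    then have "AE \<omega> in P. \<omega> \<notin> S"
      by (simp add: prob_eq_0)
    then show ?thesis
      by (rule AE_mp) (auto simp: S_def)
  qed
  then have "AE \<omega> in P. \<forall>N n\<^sub>0. N \<ge> 1 \<longrightarrow> \<not> (\<forall>n\<ge>n\<^sub>0. \<omega> \<in> A N n)"
    unfolding AE_all_countable by auto
  then show ?thesis
  proof (rule AE_mp, intro AE_I2 impI)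
    fix \<omega> assume \<omega>: "\<omega> \<in> space P" "\<forall>N n\<^sub>0. N \<ge> 1 \<longrightarrow> \<not> (\<forall>n\<ge>n\<^sub>0. \<omega> \<in> A N n)"
    show "nowhere_holder T (\<lambda>t. X t \<omega>) \<gamma>"
      unfolding nowhere_holder_def
    proof (intro ballI notI)
      fix t\<^sub>0 assume "t\<^sub>0 \<in> {0..T}" "holder_at T (\<lambda>t. X t \<omega>) \<gamma> t\<^sub>0"
      with holder_at_imp_small_increments[OF _ T _ m] obtain N :: nat where
        "N \<ge> 1" and ev: "\<forall>\<^sub>F n in sequentially. \<exists>j\<le>n.
          max_increment m (T / n) (\<lambda>t. X (j * (T / n) + t) \<omega>) \<le> N * (T / n) powr \<gamma>"
        by blast
      from ev have "\<forall>\<^sub>F n in sequentially. \<omega> \<in> A N n"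
        by eventually_elim (use \<omega>(1) in \<open>auto simp: A_def\<close>)
      with \<omega>(2) \<open>N \<ge> 1\<close> show False
        unfolding eventually_sequentially by blast
    qed
  qed
qed

text \<open>If \<open>\<tau> q\<close> were positive, the increments over the grid \<open>h, 2 h, \<dots>, (m + 1) h\<close> would be large
  with high probability as \<open>h\<close> tends to \<open>0\<close>. The grid avoids \<open>0\<close> because stochastic continuity
  says nothing about \<open>X 0\<close>.\<close>

lemma scaling_exponent_nonpos:
  assumes q: "q < 0" and m: "m \<ge> 1" and T: "T > 0"
    and cont: "stoch_continuous_at_zero P X"
    and moment: "(\<integral>\<^sup>+ \<omega>. ext_powr (max_increment m 1 (\<lambda>t. X t \<omega>)) q \<partial>P) < \<infinity>"
    and c: "moment_scaling P M T c \<tau>" and M: "abs_moment P (M T) q < \<infinity>"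
  shows "\<tau> q \<le> 0"
proof (rule ccontr)
  assume "\<not> \<tau> q \<le> 0"
  then have \<tau>: "\<tau> q > 0" by simp
  obtain K where K: "\<And>s h a. s \<ge> 0 \<Longrightarrow> 0 < h \<Longrightarrow> h \<le> T \<Longrightarrow> a > 0 \<Longrightarrow>
    prob {\<omega> \<in> space P. max_increment m h (\<lambda>t. X (s + t) \<omega>) \<le> a} \<le> K * (a powr - q * h powr \<tau> q)"
    using prob_max_increment_le[OF q m moment c M] by blast
  \<comment> \<open>Values of size at most 1/2 have differences of size at most 1, matching the
    choice \<open>a = 1\<close> in the bound from \<open>K\<close>.\<close>
  define p where "p u = prob {\<omega> \<in> space P. \<bar>X u \<omega>\<bar> > 1 / 2}" for u
  have p: "(p \<longlongrightarrow> 0) (at_right 0)"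
    using cont unfolding stoch_continuous_at_zero_def p_def
    by (elim allE[of _ "1 / 2"] impE) auto
  have "((\<lambda>h. p ((real l + 1) * h)) \<longlongrightarrow> 0) (at_right 0)" for l :: nat
    by (rule filterlim_compose[OF p], rule filterlim_times_pos[OF filterlim_ident]) auto
  then have "((\<lambda>h. \<Sum>l\<le>m. p ((real l + 1) * h)) \<longlongrightarrow> (\<Sum>l\<le>m. 0)) (at_right 0)"
    by (intro tendsto_sum)
  moreover have "((\<lambda>h. h powr \<tau> q) \<longlongrightarrow> 0) (at_right 0)"
    using \<tau> by real_asymp
  ultimately have "((\<lambda>h. K * h powr \<tau> q + (\<Sum>l\<le>m. p ((real l + 1) * h)))
      \<longlongrightarrow> K * 0 + (\<Sum>l\<le>m. 0)) (at_right 0)"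
    by (intro tendsto_add tendsto_mult tendsto_const)
  then have "((\<lambda>h. K * h powr \<tau> q + (\<Sum>l\<le>m. p ((real l + 1) * h))) \<longlongrightarrow> 0) (at_right 0)"
    by simp
  \<comment> \<open>Either all increments of the block starting at \<open>h\<close> are at most 1 or
    one of its \<open>m + 1\<close> values exceeds 1/2. These events cover the space, yet their
    total probability tends to 0.\<close>
  moreover have "\<forall>\<^sub>F h in at_right 0. 1 \<le> K * h powr \<tau> q + (\<Sum>l\<le>m. p ((real l + 1) * h))"
    using eventually_at_right_real[OF T]
  proof eventually_elim
    case (elim h)
    let ?S = "{\<omega> \<in> space P. max_increment m h (\<lambda>t. X (h + t) \<omega>) \<le> 1}"
    let ?B = "\<lambda>l. {\<omega> \<in> space P. \<bar>X ((real l + 1) * h) \<omega>\<bar> > 1 / 2}"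
    have S: "?S \<in> events"
      by (intro borel_measurable_le borel_measurable_const max_increment_X_measurable)
         (use elim in auto)
    have B: "?B l \<in> events" for l :: nat
      by (intro borel_measurable_less borel_measurable_const borel_measurable_abs X_measurable)
         (use elim in auto)
    have "\<omega> \<in> ?S \<union> (\<Union>l\<le>m. ?B l)" if \<omega>: "\<omega> \<in> space P" for \<omega>
    proof (rule ccontr)
      assume *: "\<omega> \<notin> ?S \<union> (\<Union>l\<le>m. ?B l)"
      have "max_increment m h (\<lambda>t. X (h + t) \<omega>) \<le> 1"
        unfolding max_increment_le_iff[OF m]
      proof
        fix l assume l: "l \<in> {1..m}"
        have small: "\<bar>X ((real k + 1) * h) \<omega>\<bar> \<le> 1 / 2" if "k \<le> m" for k :: nat
          using * \<omega> that by (simp add: not_less)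
        have "l \<le> m" "l - 1 \<le> m"
          using l by auto
        from this[THEN small] show "\<bar>X (h + l * h) \<omega> - X (h + (real l - 1) * h) \<omega>\<bar> \<le> 1"
          using l by (simp add: of_nat_diff algebra_simps)
      qed
      with * \<omega> show False by auto
    qed
    then have "1 \<le> prob (?S \<union> (\<Union>l\<le>m. ?B l))"
      using finite_measure_mono[of "space P" "?S \<union> (\<Union>l\<le>m. ?B l)"] S B
      by (auto simp: prob_space)
    also have "\<dots> \<le> prob ?S + prob (\<Union>l\<le>m. ?B l)"
      using S B by (intro measure_Un_le) auto
    also have "\<dots> \<le> K * h powr \<tau> q + (\<Sum>l\<le>m. p ((real l + 1) * h))"
    proof (rule add_mono)
      show "prob ?S \<le> K * h powr \<tau> q"
        using K[of h h 1] elim by simp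
      show "prob (\<Union>l\<le>m. ?B l) \<le> (\<Sum>l\<le>m. p ((real l + 1) * h))"
        unfolding p_def by (rule finite_measure_subadditive_finite) (use B in blast)+
    qed
    finally show ?case .
  qed
  ultimately have "(1::real) \<le> 0"
    by (intro tendsto_lowerbound) auto
  then show False by simp
qed

end

theorem corollary3:
  fixes P :: "'a measure"
    and X :: "real \<Rightarrow> 'a \<Rightarrow> real"
    and M :: "real \<Rightarrow> 'a \<Rightarrow> real"
    and c \<tau> :: "real \<Rightarrow> real"
    and T q :: real
  assumes "prob_space P"
    and "T > 0"
    and "measurable_process P X"
    and "separable_process P X"
    and "\<not> as_constant P X"
    and "stoch_continuous_at_zero P X"
    and "stationary_increments P X"
    and a: "\<And>\<alpha>. \<alpha> < 0 \<Longrightarrow> \<exists>m\<^sub>0::nat. m\<^sub>0 \<ge> 1 \<and>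
          (\<integral>\<^sup>+ \<omega>. ext_powr (Max ((\<lambda>l. \<bar>X (real l) \<omega> - X (real l - 1) \<omega>\<bar>) ` {1..m\<^sub>0})) \<alpha> \<partial>P) < \<infinity>"
    and b_rv: "\<And>r. r > 0 \<Longrightarrow> M r \<in> borel_measurable P"
    and b_indep: "\<And>r. r > 0 \<Longrightarrow> indep_of_process P (M r) X"
    and b_fdd: "\<And>r. r > 0 \<Longrightarrow> same_fdd P (\<lambda>t. X (r * t)) (\<lambda>t \<omega>. M r \<omega> * X t \<omega>)"
    and c: "moment_scaling P M T c \<tau>"
    and "q < 0"
    and "abs_moment P (M T) q < \<infinity>"
  shows "(AE \<omega> in P. \<forall>\<gamma> > \<tau> q / q - 1 / q. nowhere_holder T (\<lambda>t. X t \<omega>) \<gamma>)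
       \<and> (AE \<omega> in P. \<forall>t\<in>{0..T}. holder_exponent T (\<lambda>t. X t \<omega>) t \<le> H_plus P M T \<tau>)"
proof -
  interpret prob_space P by fact
  interpret scaling_process P X M
  proof
    fix t :: real assume "t \<ge> 0"
    then have "Pair t \<in> measurable P (restrict_space borel {0..} \<Otimes>\<^sub>M P)"
      by (intro measurable_Pair1') (simp add: space_restrict_space)
    from measurable_compose[OF this \<open>measurable_process P X\<close>[unfolded measurable_process_def]]
    show "X t \<in> borel_measurable P" by simp
  qed (use assms in auto)
  have moment: "\<exists>m\<ge>1. (\<integral>\<^sup>+ \<omega>. ext_powr (max_increment m 1 (\<lambda>t. X t \<omega>)) r \<partial>P) < \<infinity>"
    if "r < 0" for r
    using a[OF that] by (simp add: max_increment_def)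
  have nowhere: "AE \<omega> in P. nowhere_holder T (\<lambda>t. X t \<omega>) \<gamma>"
    if "r < 0" "abs_moment P (M T) r < \<infinity>" "\<gamma> > \<tau> r / r - 1 / r" for r \<gamma>
    using moment[OF that(1)] AE_nowhere_holder[OF that(1) _ \<open>T > 0\<close> _ c that(2,3)] by blast
  have nonneg: "\<tau> r / r - 1 / r \<ge> 0" if "r < 0" "abs_moment P (M T) r < \<infinity>" for r
  proof -
    have "\<tau> r \<le> 0"
      using moment[OF that(1)] scaling_exponent_nonpos[OF that(1) _ \<open>T > 0\<close> \<open>stoch_continuous_at_zero P X\<close> _ c that(2)]
      by blast
    then show ?thesis
      using that(1) by (simp add: field_simps)
  qed
  have H_nonneg: "H_plus P M T \<tau> \<ge> 0"
    unfolding H_plus_def by (rule INF_greatest) (use nonneg in auto)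
  \<comment> \<open>Below \<open>\<gamma>\<close> the infimum is undercut by the quotient of some
    admissible moment order, to which the result for a fixed order applies.\<close>
  have "AE \<omega> in P. nowhere_holder T (\<lambda>t. X t \<omega>) \<gamma>" if "H_plus P M T \<tau> < ereal \<gamma>" for \<gamma>
    using that nowhere unfolding H_plus_def INF_less_iff by auto
  then have "AE \<omega> in P. \<forall>\<gamma>. H_plus P M T \<tau> < ereal \<gamma> \<longrightarrow> nowhere_holder T (\<lambda>t. X t \<omega>) \<gamma>"
    by (rule AE_all_nowhere_holder)
  then have "AE \<omega> in P. \<forall>t\<in>{0..T}. holder_exponent T (\<lambda>t. X t \<omega>) t \<le> H_plus P M T \<tau>"
    by eventually_elim (use holder_exponent_le H_nonneg in blast)
  moreover have "AE \<omega> in P. \<forall>\<gamma>. ereal (\<tau> q / q - 1 / q) < ereal \<gamma> \<longrightarrow> nowhere_holder T (\<lambda>t. X t \<omega>) \<gamma>"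
    by (rule AE_all_nowhere_holder) (use nowhere \<open>q < 0\<close> \<open>abs_moment P (M T) q < \<infinity>\<close> in auto)
  ultimately show ?thesis by simp
qed

end
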